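(* Let $A$ be a real symmetric positive definite matrix, let $l\ge1$, and let $\tau\in[0,1)$ be the tolerance used for every singular value truncation in the eSIF($l$) scheme applied to $A$. Let $\tilde L$ be the resulting eSIF($l$) factor and $\tilde A=\tilde L\tilde L^T$ the resulting approximate matrix (the eSIF($l$) preconditioner). Then $\tilde A$ is always positive definite and satisfies $$\tilde A=A+E,$$ where $E$ is a positive semidefinite matrix with $$\frac{\|E\|_2}{\|A\|_2}\le(1+\tau^2)^l-1 .$$
   Context: All matrices are real, $\|\cdot\|_2$ is the spectral norm, and Cholesky factors are lower triangular with positive diagonal entries. The eSIF scheme with truncation tolerance $\tau$ is defined recursively on symmetric positive definite (SPD) matrices. At the bottom of the recursion ("level $0$"), the factor of an SPD matrix is its exact Cholesky factor. For $l\ge1$, an eSIF($l$) factor $\tilde L$ of an SPD matrix $A$ is obtained as follows. Partition $A=\begin{pmatrix}A_{11}&A_{12}\\ A_{21}&A_{22}\end{pmatrix}$ with square diagonal blocks, $A_{21}=A_{12}^T$. Let $\tilde L_1$ and $\tilde L_2$ be the level-$(l-1)$ factors of $A_{11}$ and $A_{22}$ (exact Cholesky factors if $l=1$, eSIF($l-1$) factors obtained with the same tolerance $\tau$ if $l>1$). Let $C=\tilde L_1^{-1}A_{12}\tilde L_2^{-T}$, with singular values $\sigma_1\ge\sigma_2\ge\cdots\ge\sigma_k$, where $k$ is the smaller of the row and column sizes of $C$ (all $\sigma_i<1$). Choose $r$ with $\sigma_r\ge\tau\ge\sigma_{r+1}$ (conventions: the first inequality is void if $r=0$, and $\sigma_{k+1}=0$),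 let $\Sigma_1=\operatorname{diag}(\sigma_1,\ldots,\sigma_r)$, and let $V_1$ have as columns the corresponding $r$ leading right singular vectors of $C$. Let $\tilde D_2$ be the lower triangular Cholesky factor of $I-V_1\Sigma_1^2V_1^T$ (so $I-V_1\Sigma_1^2V_1^T=\tilde D_2\tilde D_2^T$), and set $$\tilde L=\begin{pmatrix}\tilde L_1&0\\ \tilde L_2C^T&\tilde L_2\end{pmatrix}\begin{pmatrix}I&0\\0&\tilde D_2\end{pmatrix}.$$ The truncation ranks $r$ and the block sizes may differ from one step of the recursion to another. *)

theory Defs
  imports Complex_Main "Jordan_Normal_Form.Gauss_Jordan_Elimination"
begin

definition spd_mat :: "real mat \<Rightarrow> bool" where
  "spd_mat A \<longleftrightarrow> square_mat A \<and> transpose_mat A = A \<and>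
     (\<forall>x \<in> carrier_vec (dim_row A). x \<noteq> 0\<^sub>v (dim_row A) \<longrightarrow> x \<bullet> (A *\<^sub>v x) > 0)"

definition psd_mat :: "real mat \<Rightarrow> bool" where
  "psd_mat A \<longleftrightarrow> square_mat A \<and> transpose_mat A = A \<and>
     (\<forall>x \<in> carrier_vec (dim_row A). x \<bullet> (A *\<^sub>v x) \<ge> 0)"

definition vec_norm2 :: "real vec \<Rightarrow> real" where
  "vec_norm2 x = sqrt (x \<bullet> x)"

(* The supremum runs over the closed unit ball, not the unit sphere, so that the norm
   of a matrix without columns is 0. *)
definition spectral_norm :: "real mat \<Rightarrow> real" where
  "spectral_norm M = Sup {vec_norm2 (M *\<^sub>v x) | x. x \<in> carrier_vec (dim_col M) \<and> vec_norm2 x \<le> 1}"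

definition is_cholesky :: "real mat \<Rightarrow> real mat \<Rightarrow> bool" where
  "is_cholesky A L \<longleftrightarrow> L \<in> carrier_mat (dim_row A) (dim_row A) \<and>
     upper_triangular (transpose_mat L) \<and> (\<forall>i < dim_row A. L $$ (i, i) > 0) \<and>
     A = L * transpose_mat L"

(* Unspecified if A has no Cholesky factor.  The scheme below therefore carries no hidden
   assumption that the Cholesky factorizations it calls for exist. *)
definition cholesky :: "real mat \<Rightarrow> real mat" where
  "cholesky A = (SOME L. is_cholesky A L)"

(* Thin singular value decomposition; s 0, ..., s (k - 1) are the singular values in
   nonincreasing order, and the values of s from k onwards are irrelevant. *)
definition is_svd :: "real mat \<Rightarrow> real mat \<Rightarrow> (nat \<Rightarrow> real) \<Rightarrow> real mat \<Rightarrow> bool" where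
  "is_svd C U s V \<longleftrightarrow> (let k = min (dim_row C) (dim_col C) in
     U \<in> carrier_mat (dim_row C) k \<and> transpose_mat U * U = 1\<^sub>m k \<and>
     V \<in> carrier_mat (dim_col C) k \<and> transpose_mat V * V = 1\<^sub>m k \<and>
     (\<forall>i < k. 0 \<le> s i) \<and> (\<forall>i j. i \<le> j \<longrightarrow> j < k \<longrightarrow> s j \<le> s i) \<and>
     C = U * mat_diag k s * transpose_mat V)"

(* sigma_i is s (i - 1). *)
definition truncation_rank :: "real \<Rightarrow> nat \<Rightarrow> (nat \<Rightarrow> real) \<Rightarrow> nat \<Rightarrow> bool" where
  "truncation_rank \<tau> k s r \<longleftrightarrow> r \<le> k \<and>
     (0 < r \<longrightarrow> \<tau> \<le> s (r - 1)) \<and> (if r < k then s r else 0) \<le> \<tau>"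

definition leading_cols :: "nat \<Rightarrow> 'a mat \<Rightarrow> 'a mat" where
  "leading_cols r V = mat (dim_row V) r (\<lambda>(i, j). V $$ (i, j))"

definition mat_inv :: "real mat \<Rightarrow> real mat" where
  "mat_inv L = the (mat_inverse L)"

(* is_esif \<tau> l A L: L is a level-l factor of A.  It is a relation because the block sizes,
   the truncation rank and the singular vectors are choices, free at every step.
   A block may have size 0. *)
inductive is_esif :: "real \<Rightarrow> nat \<Rightarrow> real mat \<Rightarrow> real mat \<Rightarrow> bool" for \<tau> :: real where
  level_0: "is_esif \<tau> 0 A (cholesky A)"
| level_Suc: "is_esif \<tau> (Suc l) A
      (four_block_mat L1 (0\<^sub>m n1 n2) (L2 * transpose_mat C) L2 *
       four_block_mat (1\<^sub>m n1) (0\<^sub>m n1 n2) (0\<^sub>m n2 n1) D2)"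
  if "A11 \<in> carrier_mat n1 n1" and "A12 \<in> carrier_mat n1 n2" and "A22 \<in> carrier_mat n2 n2"
    and "A = four_block_mat A11 A12 (transpose_mat A12) A22"
    and "is_esif \<tau> l A11 L1" and "is_esif \<tau> l A22 L2"
    and "C = mat_inv L1 * A12 * transpose_mat (mat_inv L2)"
    and "is_svd C U s V" and "truncation_rank \<tau> (min n1 n2) s r"
    and "V1 = leading_cols r V" and "S1 = mat_diag r s"
    and "D2 = cholesky (1\<^sub>m n2 - V1 * (S1 * S1) * transpose_mat V1)"

end

theory Submission
  imports Defs "Jordan_Normal_Form.Determinant"
begin

text \<open>
  By induction on the level, \<open>x\<^sup>T A x \<le> |L\<^sup>T x|\<^sup>2\<close>, with a gap of at most
  \<open>((1 + \<tau>\<^sup>2)\<^sup>l - 1) M |x|\<^sup>2\<close> whenever \<open>M \<ge> 0\<close> and \<open>x\<^sup>T A x \<le> M |x|\<^sup>2\<close> for all \<open>x\<close>.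
  Since the factors of the diagonal blocks only enlarge \<open>A\<close>, the scaled block \<open>C\<close> is a strict
  contraction, so the next Cholesky factor exists.  The off-diagonal blocks are reproduced
  exactly; the error is block diagonal, and truncation adds to the second block a term
  \<open>L\<^sub>2 R L\<^sub>2\<^sup>T\<close> with \<open>0 \<le> R \<le> \<tau>\<^sup>2 I\<close>.  The same \<open>M\<close> bounds both diagonal blocks,
  which is why the bound is in terms of \<open>M\<close> and not relative to \<open>A\<close> in the Loewner order.
  Cauchy-Schwarz for the semidefinite form of \<open>E\<close> turns the resulting bound on
  \<open>x\<^sup>T E x\<close> into one on the spectral norm.
\<close>

section \<open>Quadratic forms\<close>

lemma scalar_prod_self_eq_sum:
  fixes x :: "real vec"
  shows "x \<bullet> x = (\<Sum>i<dim_vec x. (x $ i)\<^sup>2)"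
  by (simp add: scalar_prod_def power2_eq_square atLeast0LessThan)

lemma scalar_prod_self_nonneg:
  fixes x :: "real vec"
  shows "0 \<le> x \<bullet> x"
  by (simp add: scalar_prod_self_eq_sum sum_nonneg)

lemma scalar_prod_self_pos:
  fixes x :: "real vec"
  assumes "x \<in> carrier_vec n" and "x \<noteq> 0\<^sub>v n"
  shows "0 < x \<bullet> x"
proof -
  obtain i where i: "i < n" "x $ i \<noteq> 0"
    using assms by (metis carrier_vecD eq_vecI index_zero_vec)
  have "0 < (x $ i)\<^sup>2" using i by simp
  also have "\<dots> \<le> (\<Sum>i<dim_vec x. (x $ i)\<^sup>2)"
    using i assms by (intro member_le_sum) auto
  finally show ?thesis by (simp add: scalar_prod_self_eq_sum)
qed

lemma scalar_prod_mult_mat_vec: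
  fixes A :: "real mat"
  assumes "A \<in> carrier_mat nr nc" "x \<in> carrier_vec nc" "y \<in> carrier_vec nr"
  shows "y \<bullet> (A *\<^sub>v x) = (transpose_mat A *\<^sub>v y) \<bullet> x"
  using transpose_vec_mult_scalar[OF assms] by simp

text \<open>Replaces the form of \<open>L L^T\<close> by a squared norm, so that a factor can be
  compared with \<open>A\<close> through \<open>|L^T x|^2\<close> alone.\<close>

lemma gram_form:
  fixes L :: "real mat"
  assumes L: "L \<in> carrier_mat n k" and x: "x \<in> carrier_vec n"
  shows "x \<bullet> ((L * transpose_mat L) *\<^sub>v x) = (transpose_mat L *\<^sub>v x) \<bullet> (transpose_mat L *\<^sub>v x)"
proof -
  have "(L * transpose_mat L) *\<^sub>v x = L *\<^sub>v (transpose_mat L *\<^sub>v x)"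
    using L x by (intro assoc_mult_mat_vec[of _ n k _ n]) auto
  then show ?thesis
    using scalar_prod_mult_mat_vec[OF L, of "transpose_mat L *\<^sub>v x" x] L x by simp
qed

lemma scalar_prod_self_add:
  fixes x y :: "real vec"
  assumes "x \<in> carrier_vec n" "y \<in> carrier_vec n"
  shows "(x + y) \<bullet> (x + y) = x \<bullet> x + 2 * (x \<bullet> y) + y \<bullet> y"
  using assms comm_scalar_prod[of y n x]
  by (simp add: add_scalar_prod_distrib[of _ n] scalar_prod_add_distrib[of _ n])

text \<open>The two off-diagonal contributions are transposes of one scalar, hence the factor 2.
  Isolating this cross term lets it cancel later between \<open>A\<close> and its
  approximation.\<close>

lemma four_block_form:
  fixes A :: "real mat"
  assumes A: "A \<in> carrier_mat n1 n1" and B: "B \<in> carrier_mat n1 n2" and D: "D \<in> carrier_mat n2 n2"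
    and u: "u \<in> carrier_vec n1" and v: "v \<in> carrier_vec n2"
  shows "(u @\<^sub>v v) \<bullet> (four_block_mat A B (transpose_mat B) D *\<^sub>v (u @\<^sub>v v)) =
    u \<bullet> (A *\<^sub>v u) + 2 * (u \<bullet> (B *\<^sub>v v)) + v \<bullet> (D *\<^sub>v v)"
proof -
  have "four_block_mat A B (transpose_mat B) D *\<^sub>v (u @\<^sub>v v) =
      (A *\<^sub>v u + B *\<^sub>v v) @\<^sub>v (transpose_mat B *\<^sub>v u + D *\<^sub>v v)"
    using B by (intro four_block_mat_mult_vec[OF A B _ D u v]) auto
  moreover have "v \<bullet> (transpose_mat B *\<^sub>v u) = u \<bullet> (B *\<^sub>v v)"
    using scalar_prod_mult_mat_vec[OF B v u] comm_scalar_prod[of v n2 "transpose_mat B *\<^sub>v u"] B u v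
    by simp
  moreover have "u \<bullet> (A *\<^sub>v u + B *\<^sub>v v) = u \<bullet> (A *\<^sub>v u) + u \<bullet> (B *\<^sub>v v)"
    using A B u v by (intro scalar_prod_add_distrib[of _ n1]) auto
  moreover have "v \<bullet> (transpose_mat B *\<^sub>v u + D *\<^sub>v v) = v \<bullet> (transpose_mat B *\<^sub>v u) + v \<bullet> (D *\<^sub>v v)"
    using B D u v by (intro scalar_prod_add_distrib[of _ n2]) auto
  ultimately show ?thesis
    using scalar_prod_append[of u n1 v n2 "A *\<^sub>v u + B *\<^sub>v v" "transpose_mat B *\<^sub>v u + D *\<^sub>v v"] A B D u v
    by simp
qed

section \<open>Positive definite matrices, their diagonal blocks and invertible factors\<close>

lemma spd_mat_pos:
  assumes "spd_mat A" "A \<in> carrier_mat n n" "x \<in> carrier_vec n" "x \<noteq> 0\<^sub>v n"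
  shows "0 < x \<bullet> (A *\<^sub>v x)"
  using assms by (auto simp: spd_mat_def)

lemma spd_matI:
  assumes "A \<in> carrier_mat n n" and "transpose_mat A = A"
    and "\<And>x. x \<in> carrier_vec n \<Longrightarrow> x \<noteq> 0\<^sub>v n \<Longrightarrow> 0 < x \<bullet> (A *\<^sub>v x)"
  shows "spd_mat A"
  using assms by (auto simp: spd_mat_def)

lemma append_vec_eq_zero_iff:
  fixes u v :: "real vec"
  assumes "u \<in> carrier_vec n1" "v \<in> carrier_vec n2"
  shows "u @\<^sub>v v = 0\<^sub>v (n1 + n2) \<longleftrightarrow> u = 0\<^sub>v n1 \<and> v = 0\<^sub>v n2"
proof -
  have "0\<^sub>v (n1 + n2) = 0\<^sub>v n1 @\<^sub>v 0\<^sub>v n2" by (intro eq_vecI) auto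
  then show ?thesis using append_vec_eq[OF assms(1) zero_carrier_vec] by metis
qed

lemma mult_mat_zero_vec:
  fixes A :: "real mat"
  assumes "A \<in> carrier_mat m n"
  shows "A *\<^sub>v 0\<^sub>v n = 0\<^sub>v m"
  using assms by (intro eq_vecI) (auto simp: scalar_prod_def)

text \<open>Vectors padded with zeros restrict the form to one diagonal block; symmetry of each
  block is read off entrywise from the symmetry of the whole.\<close>

lemma spd_four_block:
  fixes A :: "real mat"
  assumes A: "A \<in> carrier_mat n1 n1" and B: "B \<in> carrier_mat n1 n2" and D: "D \<in> carrier_mat n2 n2"
    and spd: "spd_mat (four_block_mat A B (transpose_mat B) D)"
  shows "spd_mat A" and "spd_mat D"
proof -
  let ?M = "four_block_mat A B (transpose_mat B) D"
  have M: "?M \<in> carrier_mat (n1 + n2) (n1 + n2)" using A D by simp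
  have "transpose_mat ?M = four_block_mat (transpose_mat A) B (transpose_mat B) (transpose_mat D)"
    using transpose_four_block_mat[OF A B _ D, of "transpose_mat B"] B by simp
  then have eq: "four_block_mat (transpose_mat A) B (transpose_mat B) (transpose_mat D) = ?M"
    using spd by (simp add: spd_mat_def)
  have At: "transpose_mat A = A"
  proof (rule eq_matI)
    fix i j assume ij: "i < dim_row A" "j < dim_col A"
    then show "transpose_mat A $$ (i, j) = A $$ (i, j)"
      using arg_cong[OF eq, of "\<lambda>M. M $$ (i, j)"] A B D by simp
  qed (use A in auto)
  have Dt: "transpose_mat D = D"
  proof (rule eq_matI)
    fix i j assume ij: "i < dim_row D" "j < dim_col D"
    then show "transpose_mat D $$ (i, j) = D $$ (i, j)"
      using arg_cong[OF eq, of "\<lambda>M. M $$ (i + n1, j + n1)"] A B D by simp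
  qed (use D in auto)
  show "spd_mat A"
  proof (rule spd_matI[OF A At])
    fix x :: "real vec" assume x: "x \<in> carrier_vec n1" "x \<noteq> 0\<^sub>v n1"
    have "0 < (x @\<^sub>v 0\<^sub>v n2) \<bullet> (?M *\<^sub>v (x @\<^sub>v 0\<^sub>v n2))"
      using x append_vec_eq_zero_iff[of x n1 "0\<^sub>v n2" n2] by (intro spd_mat_pos[OF spd M]) auto
    then show "0 < x \<bullet> (A *\<^sub>v x)"
      using four_block_form[OF A B D x(1), of "0\<^sub>v n2"] mult_mat_zero_vec[OF B] D x by simp
  qed
  show "spd_mat D"
  proof (rule spd_matI[OF D Dt])
    fix x :: "real vec" assume x: "x \<in> carrier_vec n2" "x \<noteq> 0\<^sub>v n2"
    have "0 < (0\<^sub>v n1 @\<^sub>v x) \<bullet> (?M *\<^sub>v (0\<^sub>v n1 @\<^sub>v x))"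
      using x append_vec_eq_zero_iff[of "0\<^sub>v n1" n1 x n2] by (intro spd_mat_pos[OF spd M]) auto
    then show "0 < x \<bullet> (D *\<^sub>v x)"
      using four_block_form[OF A B D _ x(1), of "0\<^sub>v n1"] A B D x by simp
  qed
qed

text \<open>\<open>mat_inv\<close> takes \<open>the\<close> of an option, so it means something only
  once \<open>None\<close> is excluded; a nonzero determinant does that.\<close>

lemma mat_inv_inverse:
  assumes A: "A \<in> carrier_mat n n" and det: "det A \<noteq> 0"
  shows "A * mat_inv A = 1\<^sub>m n" "mat_inv A * A = 1\<^sub>m n" "mat_inv A \<in> carrier_mat n n"
proof -
  obtain B where B: "mat_inverse A = Some B"
    using mat_inverse(1)[OF A, of "()"] det_non_zero_imp_unit[OF A det, of "()"] by blast
  then show "A * mat_inv A = 1\<^sub>m n" "mat_inv A * A = 1\<^sub>m n" "mat_inv A \<in> carrier_mat n n"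
    using mat_inverse(2)[OF A B] by (auto simp: mat_inv_def)
qed

text \<open>A nonzero kernel vector of \<open>L^T\<close> would force the positive form of
  \<open>A\<close> to be at most 0. This makes approximate factors invertible without using their
  triangular shape.\<close>

lemma det_nonzero_of_dominates_spd:
  assumes A: "A \<in> carrier_mat n n" and spd: "spd_mat A" and L: "L \<in> carrier_mat n n"
    and le: "\<And>x. x \<in> carrier_vec n \<Longrightarrow> x \<bullet> (A *\<^sub>v x) \<le> (transpose_mat L *\<^sub>v x) \<bullet> (transpose_mat L *\<^sub>v x)"
  shows "det L \<noteq> 0"
proof
  assume "det L = 0"
  then have "det (transpose_mat L) = 0" using det_transpose[OF L] by simp
  then obtain x where x: "x \<in> carrier_vec n" "x \<noteq> 0\<^sub>v n" "transpose_mat L *\<^sub>v x = 0\<^sub>v n"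
    using det_0_iff_vec_prod_zero[of "transpose_mat L" n] L by auto
  show False using le[OF x(1)] spd_mat_pos[OF spd A x(1,2)] x(3) by simp
qed

text \<open>Evaluating the form of the block matrix at \<open>(u, v)\<close> with \<open>L\<^sup>T u = - B v\<close>
  minimises an upper bound over \<open>u\<close>.\<close>
lemma spd_four_block_contraction:
  fixes A :: "real mat"
  assumes A: "A \<in> carrier_mat n1 n1" and B: "B \<in> carrier_mat n1 n2" and D: "D \<in> carrier_mat n2 n2"
    and L: "L \<in> carrier_mat n1 n1" and det: "det L \<noteq> 0"
    and spd: "spd_mat (four_block_mat A (L * B) (transpose_mat (L * B)) D)"
    and le: "\<And>x. x \<in> carrier_vec n1 \<Longrightarrow> x \<bullet> (A *\<^sub>v x) \<le> (transpose_mat L *\<^sub>v x) \<bullet> (transpose_mat L *\<^sub>v x)"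
    and v: "v \<in> carrier_vec n2" "v \<noteq> 0\<^sub>v n2"
  shows "(B *\<^sub>v v) \<bullet> (B *\<^sub>v v) < v \<bullet> (D *\<^sub>v v)"
proof -
  let ?b = "B *\<^sub>v v" and ?Lt = "transpose_mat L"
  have b: "?b \<in> carrier_vec n1" using B v by simp
  have LB: "L * B \<in> carrier_mat n1 n2" using L B by simp
  have Lt: "?Lt \<in> carrier_mat n1 n1" "det ?Lt \<noteq> 0" using L det det_transpose[OF L] by auto
  define u where "u = mat_inv ?Lt *\<^sub>v (- ?b)"
  have u: "u \<in> carrier_vec n1" using mat_inv_inverse(3)[OF Lt] b by (simp add: u_def)
  have "?Lt *\<^sub>v u = (?Lt * mat_inv ?Lt) *\<^sub>v (- ?b)"
    unfolding u_def using Lt mat_inv_inverse(3)[OF Lt] b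
    by (intro assoc_mult_mat_vec[symmetric]) auto
  then have Lu: "?Lt *\<^sub>v u = - ?b" using mat_inv_inverse(1)[OF Lt] b by simp
  \<comment> \<open>Only \<open>v\<close> is known to be nonzero, which suffices for the strict
    inequality; \<open>u\<close> may vanish.\<close>
  have "(u @\<^sub>v v) \<in> carrier_vec (n1 + n2)" "u @\<^sub>v v \<noteq> 0\<^sub>v (n1 + n2)"
    using u v append_vec_eq_zero_iff[OF u v(1)] by auto
  then have "0 < (u @\<^sub>v v) \<bullet> (four_block_mat A (L * B) (transpose_mat (L * B)) D *\<^sub>v (u @\<^sub>v v))"
    using A D by (intro spd_mat_pos[OF spd]) auto
  also have "\<dots> = u \<bullet> (A *\<^sub>v u) + 2 * (u \<bullet> ((L * B) *\<^sub>v v)) + v \<bullet> (D *\<^sub>v v)"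
    by (rule four_block_form[OF A LB D u v(1)])
  \<comment> \<open>The doubled cross term is \<open>-2 |B v|^2\<close> and the first term is at
    most \<open>|B v|^2\<close>, so what remains is at most
    \<open>v^T D v - |B v|^2\<close>.\<close>
  also have "u \<bullet> ((L * B) *\<^sub>v v) = - (?b \<bullet> ?b)"
    using scalar_prod_mult_mat_vec[OF L b u] L B v b by (simp add: Lu)
  also have "u \<bullet> (A *\<^sub>v u) \<le> ?b \<bullet> ?b"
    using le[OF u] b by (simp add: Lu)
  finally show ?thesis by simp
qed

section \<open>Existence of Cholesky factors\<close>

text \<open>Induction on the size, splitting off the last row and column. The leading block is
  factored by the induction hypothesis, and the Schur complement is a single positive number whose
  root is the new diagonal entry.\<close>

lemma spd_has_cholesky:
  assumes "A \<in> carrier_mat n n" "spd_mat A"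
  shows "\<exists>L. is_cholesky A L"
  using assms
proof (induction n arbitrary: A)
  case 0
  then have "is_cholesky A (1\<^sub>m 0)" by (auto simp: is_cholesky_def intro!: eq_matI)
  then show ?case by blast
next
  case (Suc n)
  obtain A1 A2 A3 A4 where split: "split_block A n n = (A1, A2, A3, A4)"
    by (metis prod_cases4)
  have c: "A1 \<in> carrier_mat n n" "A2 \<in> carrier_mat n 1" "A3 \<in> carrier_mat 1 n" "A4 \<in> carrier_mat 1 1"
    and A4b: "A = four_block_mat A1 A2 A3 A4"
    using split_block[OF split, of 1 1] Suc.prems by auto
  have At: "transpose_mat A = A" using Suc.prems by (simp add: spd_mat_def)
  have A3: "A3 = transpose_mat A2"
  proof (rule eq_matI)
    fix i j assume "i < dim_row (transpose_mat A2)" "j < dim_col (transpose_mat A2)"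
    then show "A3 $$ (i, j) = transpose_mat A2 $$ (i, j)"
      using arg_cong[OF At, of "\<lambda>M. M $$ (i + n, j)"] c unfolding A4b by simp
  qed (use c in auto)
  have spd: "spd_mat (four_block_mat A1 A2 (transpose_mat A2) A4)"
    using Suc.prems A4b A3 by simp
  obtain L where L: "is_cholesky A1 L"
    using Suc.IH[OF c(1)] spd_four_block[OF c(1,2,4) spd] by blast
  then have Lc: "L \<in> carrier_mat n n" and ut: "upper_triangular (transpose_mat L)"
    and Lpos: "\<And>i. i < n \<Longrightarrow> 0 < L $$ (i, i)" and A1: "A1 = L * transpose_mat L"
    using c by (auto simp: is_cholesky_def)
  have le: "x \<bullet> (A1 *\<^sub>v x) \<le> (transpose_mat L *\<^sub>v x) \<bullet> (transpose_mat L *\<^sub>v x)"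
    if "x \<in> carrier_vec n" for x
    using gram_form[OF Lc that] A1 by simp
  have det: "det L \<noteq> 0"
    using det_nonzero_of_dominates_spd[OF c(1) spd_four_block(1)[OF c(1,2,4) spd] Lc le] .
  \<comment> \<open>The solution of \<open>L B = A2\<close>; its transpose becomes the last row of
    the new factor, left of the diagonal.\<close>
  define B where "B = mat_inv L * A2"
  have B: "B \<in> carrier_mat n 1" using mat_inv_inverse[OF Lc det] c by (simp add: B_def)
  have LB: "L * B = A2"
    using mat_inv_inverse[OF Lc det] c Lc
    by (simp add: B_def assoc_mult_mat[of L n n "mat_inv L" n A2 1, symmetric])
  define q where "q = A4 $$ (0, 0) - (transpose_mat B * B) $$ (0, 0)"
  have q: "0 < q"
  proof -
    let ?v = "unit_vec 1 0 :: real vec"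
    \<comment> \<open>In dimension 1 the contraction inequality at the unit vector is exactly
      positivity of the Schur complement \<open>q\<close>.\<close>
    have "(B *\<^sub>v ?v) \<bullet> (B *\<^sub>v ?v) < ?v \<bullet> (A4 *\<^sub>v ?v)"
      using spd LB by (intro spd_four_block_contraction[OF c(1) B c(4) Lc det _ le]) auto
    moreover have "B *\<^sub>v ?v = col B 0" using B by (auto intro!: eq_vecI simp: scalar_prod_def)
    moreover have "?v \<bullet> (A4 *\<^sub>v ?v) = A4 $$ (0, 0)" using c by (auto simp: scalar_prod_def)
    ultimately show ?thesis using B by (simp add: q_def)
  qed
  define d where "d = mat 1 1 (\<lambda>_. sqrt q)"
  have d: "d \<in> carrier_mat 1 1" by (simp add: d_def)
  let ?L = "four_block_mat L (0\<^sub>m n 1) (transpose_mat B) d"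
  have Lt: "transpose_mat ?L = four_block_mat (transpose_mat L) B (0\<^sub>m 1 n) (transpose_mat d)"
    using transpose_four_block_mat[of L n n "0\<^sub>m n 1" 1 "transpose_mat B" 1 d] Lc B d by simp
  have "?L * transpose_mat ?L = four_block_mat (L * transpose_mat L) (L * B)
      (transpose_mat B * transpose_mat L) (transpose_mat B * B + d * transpose_mat d)"
    unfolding Lt using Lc B d
    by (subst mult_four_block_mat[of _ n n _ 1 _ 1 _ _ n _ 1]) auto
  moreover have "transpose_mat B * transpose_mat L = A3"
    using transpose_mult[OF Lc B] LB A3 by simp
  moreover have "transpose_mat B * B + d * transpose_mat d = A4"
    using q c B by (auto intro!: eq_matI simp: d_def scalar_prod_def q_def power2_eq_square[symmetric])
  ultimately have "A = ?L * transpose_mat ?L"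
    using A1 A4b LB by simp
  moreover have "?L \<in> carrier_mat (dim_row A) (dim_row A)"
    using four_block_carrier_mat[OF Lc d] Suc.prems by simp
  moreover have "upper_triangular (transpose_mat ?L)"
    unfolding Lt using ut Lc d B by (intro upper_triangular_four_block) (auto simp: upper_triangular_def)
  moreover have "\<forall>i < dim_row A. 0 < ?L $$ (i, i)"
    using Lpos Lc d q Suc.prems by (auto simp: d_def)
  ultimately show ?case unfolding is_cholesky_def by blast
qed

text \<open>\<open>cholesky\<close> is a choice, so its defining property is available only after
  positive definiteness has been shown. Every use below has to supply that first.\<close>

lemma cholesky_gram:
  assumes "A \<in> carrier_mat n n" "spd_mat A"
  shows "cholesky A \<in> carrier_mat n n" "cholesky A * transpose_mat (cholesky A) = A"
proof -
  have "is_cholesky A (cholesky A)"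
    unfolding cholesky_def using someI_ex[OF spd_has_cholesky[OF assms]] .
  then show "cholesky A \<in> carrier_mat n n" "cholesky A * transpose_mat (cholesky A) = A"
    using assms(1) by (auto simp: is_cholesky_def)
qed

section \<open>Truncated singular value decompositions\<close>

lemma orthonormal_cols_isometry:
  fixes U :: "real mat"
  assumes U: "U \<in> carrier_mat n k" and orth: "transpose_mat U * U = 1\<^sub>m k"
    and y: "y \<in> carrier_vec k"
  shows "(U *\<^sub>v y) \<bullet> (U *\<^sub>v y) = y \<bullet> y"
proof -
  have "transpose_mat U *\<^sub>v (U *\<^sub>v y) = y"
    using assoc_mult_mat_vec[of "transpose_mat U" k n U k y] U y orth by simp
  then show ?thesis using scalar_prod_mult_mat_vec[OF U y, of "U *\<^sub>v y"] U y by simp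
qed

text \<open>Expand \<open>0 <= |w - V V^T w|^2\<close>; orthonormality reduces the right side to
  \<open>|w|^2 - |V^T w|^2\<close>. Equality can fail because a thin \<open>V\<close> need not span
  the whole space.\<close>

lemma bessel_inequality:
  fixes V :: "real mat"
  assumes V: "V \<in> carrier_mat n k" and orth: "transpose_mat V * V = 1\<^sub>m k"
    and w: "w \<in> carrier_vec n"
  shows "(transpose_mat V *\<^sub>v w) \<bullet> (transpose_mat V *\<^sub>v w) \<le> w \<bullet> w"
proof -
  define z where "z = transpose_mat V *\<^sub>v w"
  have z: "z \<in> carrier_vec k" using V w by (simp add: z_def)
  have "0 \<le> (w + V *\<^sub>v (- z)) \<bullet> (w + V *\<^sub>v (- z))" by (rule scalar_prod_self_nonneg)
  also have "\<dots> = w \<bullet> w + 2 * (w \<bullet> (V *\<^sub>v (- z))) + (V *\<^sub>v (- z)) \<bullet> (V *\<^sub>v (- z))"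
    using V w z by (intro scalar_prod_self_add[of _ n]) auto
  also have "(V *\<^sub>v (- z)) \<bullet> (V *\<^sub>v (- z)) = z \<bullet> z"
    using orthonormal_cols_isometry[OF V orth, of "- z"] z by simp
  also have "w \<bullet> (V *\<^sub>v (- z)) = - (z \<bullet> z)"
    using scalar_prod_mult_mat_vec[OF V _ w, of "- z"] z by (simp add: z_def[symmetric])
  finally show ?thesis by (simp add: z_def)
qed

lemma mat_diag_mult_vec:
  fixes f :: "nat \<Rightarrow> real"
  assumes "y \<in> carrier_vec n"
  shows "mat_diag n f *\<^sub>v y = vec n (\<lambda>i. f i * y $ i)"
proof (rule eq_vecI)
  fix i assume "i < dim_vec (vec n (\<lambda>i. f i * y $ i))"
  then have i: "i < n" by simp
  have "(mat_diag n f *\<^sub>v y) $ i = (\<Sum>j<n. (if i = j then f j else 0) * y $ j)"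
    using i assms by (simp add: mat_diag_def scalar_prod_def atLeast0LessThan)
  also have "\<dots> = (\<Sum>j<n. if i = j then f j * y $ j else 0)"
    by (intro sum.cong) auto
  finally show "(mat_diag n f *\<^sub>v y) $ i = vec n (\<lambda>i. f i * y $ i) $ i"
    using i by simp
qed (simp add: mat_diag_def)

text \<open>\<open>U\<close> is an isometry and drops out. The norm is thus expressed in the
  coordinates \<open>V^T w\<close>, the same ones in which the truncated complement is
  diagonal.\<close>

lemma is_svd_norm:
  assumes svd: "is_svd C U s V" and C: "C \<in> carrier_mat n1 n2" and w: "w \<in> carrier_vec n2"
  shows "(C *\<^sub>v w) \<bullet> (C *\<^sub>v w) = (\<Sum>i<min n1 n2. (s i)\<^sup>2 * ((transpose_mat V *\<^sub>v w) $ i)\<^sup>2)"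
proof -
  let ?k = "min n1 n2"
  let ?S = "mat_diag ?k s" and ?z = "transpose_mat V *\<^sub>v w"
  have U: "U \<in> carrier_mat n1 ?k" "transpose_mat U * U = 1\<^sub>m ?k"
    and V: "V \<in> carrier_mat n2 ?k" and Ceq: "C = U * ?S * transpose_mat V"
    using svd C by (auto simp: is_svd_def Let_def)
  have z: "?z \<in> carrier_vec ?k" using V w by simp
  have S: "?S \<in> carrier_mat ?k ?k" by simp
  have "C *\<^sub>v w = (U * ?S) *\<^sub>v ?z"
    unfolding Ceq using U(1) V w S by (intro assoc_mult_mat_vec[of _ n1 ?k _ n2]) auto
  also have "\<dots> = U *\<^sub>v (?S *\<^sub>v ?z)"
    using U(1) z S by (intro assoc_mult_mat_vec[of _ n1 ?k _ ?k]) auto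
  finally have "(C *\<^sub>v w) \<bullet> (C *\<^sub>v w) = (?S *\<^sub>v ?z) \<bullet> (?S *\<^sub>v ?z)"
    using orthonormal_cols_isometry[OF U, of "?S *\<^sub>v ?z"] z S by simp
  then show ?thesis
    by (simp add: mat_diag_mult_vec[OF z] scalar_prod_self_eq_sum power_mult_distrib)
qed

lemma truncated_complement_form:
  fixes V :: "real mat" and s :: "nat \<Rightarrow> real"
  assumes V: "V \<in> carrier_mat n k" and r: "r \<le> k" and w: "w \<in> carrier_vec n"
  defines "V1 \<equiv> leading_cols r V"
  defines "T \<equiv> 1\<^sub>m n - V1 * (mat_diag r s * mat_diag r s) * transpose_mat V1"
  shows "T \<in> carrier_mat n n" and "transpose_mat T = T"
    and "w \<bullet> (T *\<^sub>v w) = w \<bullet> w - (\<Sum>i<r. (s i)\<^sup>2 * ((transpose_mat V *\<^sub>v w) $ i)\<^sup>2)"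
proof -
  \<comment> \<open>The squared singular values as one diagonal matrix, to which simplification
    reduces the product in \<open>T\<close>.\<close>
  define S where "S = mat_diag r (\<lambda>i. s i * s i)"
  have S: "S \<in> carrier_mat r r" "transpose_mat S = S"
    by (auto simp: S_def mat_diag_def intro!: eq_matI)
  have V1: "V1 \<in> carrier_mat n r" using V by (simp add: V1_def leading_cols_def)
  have T_eq: "T = 1\<^sub>m n - V1 * S * transpose_mat V1" by (simp add: T_def S_def)
  have P: "V1 * S * transpose_mat V1 \<in> carrier_mat n n" using V1 S by simp
  have "transpose_mat (V1 * S * transpose_mat V1) = V1 * (S * transpose_mat V1)"
    using transpose_mult[of "V1 * S" n r "transpose_mat V1" n] transpose_mult[OF V1 S(1)] V1 S
    by simp
  also have "\<dots> = V1 * S * transpose_mat V1" using V1 S by (intro assoc_mult_mat[symmetric]) auto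
  finally have Pt: "transpose_mat (V1 * S * transpose_mat V1) = V1 * S * transpose_mat V1" .
  show "T \<in> carrier_mat n n" unfolding T_eq using P by (rule minus_carrier_mat)
  show "transpose_mat T = T" using transpose_minus[OF one_carrier_mat P] Pt by (simp add: T_eq)
  let ?z = "transpose_mat V1 *\<^sub>v w"
  have z: "?z \<in> carrier_vec r" using V1 w by simp
  \<comment> \<open>Dropping columns of \<open>V\<close> merely drops coordinates, so the truncated
    form is an initial segment of the sum for \<open>C\<close>.\<close>
  have zi: "?z $ i = (transpose_mat V *\<^sub>v w) $ i" if "i < r" for i
  proof -
    have "col V1 i = col V i" using that r V
      by (intro eq_vecI) (auto simp: V1_def leading_cols_def)
    then show ?thesis using that r V V1 by simp
  qed
  have "(V1 * S * transpose_mat V1) *\<^sub>v w = (V1 * S) *\<^sub>v ?z"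
    using V1 S w by (intro assoc_mult_mat_vec[of _ n r _ n]) auto
  also have "\<dots> = V1 *\<^sub>v (S *\<^sub>v ?z)"
    using V1 S z by (intro assoc_mult_mat_vec[of _ n r _ r]) auto
  finally have "w \<bullet> ((V1 * S * transpose_mat V1) *\<^sub>v w) = ?z \<bullet> (S *\<^sub>v ?z)"
    using scalar_prod_mult_mat_vec[OF V1 _ w, of "S *\<^sub>v ?z"] S z by simp
  also have "\<dots> = (\<Sum>i<r. (s i)\<^sup>2 * (?z $ i)\<^sup>2)"
    using z by (simp add: S_def mat_diag_mult_vec[OF z] scalar_prod_def atLeast0LessThan
        power2_eq_square ac_simps)
  also have "\<dots> = (\<Sum>i<r. (s i)\<^sup>2 * ((transpose_mat V *\<^sub>v w) $ i)\<^sup>2)"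
    using zi by (intro sum.cong) auto
  finally have *: "w \<bullet> ((V1 * S * transpose_mat V1) *\<^sub>v w) =
    (\<Sum>i<r. (s i)\<^sup>2 * ((transpose_mat V *\<^sub>v w) $ i)\<^sup>2)" .
  have "T *\<^sub>v w = w - (V1 * S * transpose_mat V1) *\<^sub>v w"
    using minus_mult_distrib_mat_vec[OF one_carrier_mat P w] w by (simp add: T_eq)
  then show "w \<bullet> (T *\<^sub>v w) = w \<bullet> w - (\<Sum>i<r. (s i)\<^sup>2 * ((transpose_mat V *\<^sub>v w) $ i)\<^sup>2)"
    using scalar_prod_minus_distrib[OF w w, of "(V1 * S * transpose_mat V1) *\<^sub>v w"] P w * by simp
qed

text \<open>In the coordinates \<open>V^T w\<close>, \<open>|C w|^2\<close> is a head sum over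
  \<open>i < r\<close> plus a tail sum, and \<open>|D2^T w|^2\<close> is \<open>|w|^2\<close> minus
  the head. Adding them cancels the head, so the truncation error is exactly the tail, which lies
  between 0 and \<open>\<tau>\<^sup>2 |w|^2\<close>.\<close>

lemma truncated_factor_bounds:
  assumes C: "C \<in> carrier_mat n1 n2" and svd: "is_svd C U s V"
    and rank: "truncation_rank \<tau> (min n1 n2) s r" and \<tau>: "0 \<le> \<tau>"
    and contr: "\<And>w. w \<in> carrier_vec n2 \<Longrightarrow> w \<noteq> 0\<^sub>v n2 \<Longrightarrow> (C *\<^sub>v w) \<bullet> (C *\<^sub>v w) < w \<bullet> w"
  defines "V1 \<equiv> leading_cols r V"
  defines "D2 \<equiv> cholesky (1\<^sub>m n2 - V1 * (mat_diag r s * mat_diag r s) * transpose_mat V1)"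
  shows "D2 \<in> carrier_mat n2 n2"
    and "w \<in> carrier_vec n2 \<Longrightarrow>
      w \<bullet> w \<le> (C *\<^sub>v w) \<bullet> (C *\<^sub>v w) + (transpose_mat D2 *\<^sub>v w) \<bullet> (transpose_mat D2 *\<^sub>v w)"
    and "w \<in> carrier_vec n2 \<Longrightarrow>
      (C *\<^sub>v w) \<bullet> (C *\<^sub>v w) + (transpose_mat D2 *\<^sub>v w) \<bullet> (transpose_mat D2 *\<^sub>v w) \<le> (1 + \<tau>\<^sup>2) * (w \<bullet> w)"
proof -
  let ?k = "min n1 n2"
  define T where "T = 1\<^sub>m n2 - V1 * (mat_diag r s * mat_diag r s) * transpose_mat V1"
  define g where "g w i = (s i)\<^sup>2 * ((transpose_mat V *\<^sub>v w) $ i)\<^sup>2" for w i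
  have V: "V \<in> carrier_mat n2 ?k" "transpose_mat V * V = 1\<^sub>m ?k"
    and s: "\<And>i. i < ?k \<Longrightarrow> 0 \<le> s i" "\<And>i j. i \<le> j \<Longrightarrow> j < ?k \<Longrightarrow> s j \<le> s i"
    using svd C by (auto simp: is_svd_def Let_def)
  have r: "r \<le> ?k" "r < ?k \<Longrightarrow> s r \<le> \<tau>"
    using rank by (auto simp: truncation_rank_def)
  have T: "T \<in> carrier_mat n2 n2" "transpose_mat T = T"
    using truncated_complement_form(1,2)[OF V(1) r(1) zero_carrier_vec]
    unfolding T_def V1_def by blast+
  have form: "w \<bullet> (T *\<^sub>v w) = w \<bullet> w - sum (g w) {..<r}" if "w \<in> carrier_vec n2" for w
    unfolding T_def V1_def g_def by (rule truncated_complement_form(3)[OF V(1) r(1) that])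
  have norm_C: "(C *\<^sub>v w) \<bullet> (C *\<^sub>v w) = sum (g w) {..<r} + sum (g w) {r..<?k}"
    if "w \<in> carrier_vec n2" for w
    using is_svd_norm[OF svd C that] sum.atLeastLessThan_concat[of 0 r ?k "g w"] r(1)
    by (simp add: g_def[abs_def] atLeast0LessThan)
  have tail_nonneg: "0 \<le> sum (g w) {r..<?k}" for w
    by (intro sum_nonneg) (simp add: g_def)
  \<comment> \<open>The form of \<open>T\<close> is \<open>|w|^2\<close> minus the head, hence at
    least \<open>|w|^2 - |C w|^2\<close>, and strict contraction makes this positive.\<close>
  have "spd_mat T"
  proof (rule spd_matI[OF T])
    fix w :: "real vec" assume w: "w \<in> carrier_vec n2" "w \<noteq> 0\<^sub>v n2"
    then show "0 < w \<bullet> (T *\<^sub>v w)"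
      using contr[OF w] norm_C[OF w(1)] form[OF w(1)] tail_nonneg[of w] by simp
  qed
  then have D2: "D2 \<in> carrier_mat n2 n2" "D2 * transpose_mat D2 = T"
    using cholesky_gram[OF T(1)] unfolding D2_def T_def by blast+
  show "D2 \<in> carrier_mat n2 n2" by (rule D2(1))
  have sum_eq: "(C *\<^sub>v w) \<bullet> (C *\<^sub>v w) + (transpose_mat D2 *\<^sub>v w) \<bullet> (transpose_mat D2 *\<^sub>v w) =
      w \<bullet> w + sum (g w) {r..<?k}" if "w \<in> carrier_vec n2" for w
    using gram_form[OF D2(1) that] D2(2) form[OF that] norm_C[OF that] by simp
  show "w \<bullet> w \<le> (C *\<^sub>v w) \<bullet> (C *\<^sub>v w) + (transpose_mat D2 *\<^sub>v w) \<bullet> (transpose_mat D2 *\<^sub>v w)"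
    if "w \<in> carrier_vec n2"
    using sum_eq[OF that] tail_nonneg[of w] by simp
  show "(C *\<^sub>v w) \<bullet> (C *\<^sub>v w) + (transpose_mat D2 *\<^sub>v w) \<bullet> (transpose_mat D2 *\<^sub>v w) \<le> (1 + \<tau>\<^sup>2) * (w \<bullet> w)"
    if w: "w \<in> carrier_vec n2"
  proof -
    let ?z = "transpose_mat V *\<^sub>v w"
    have "sum (g w) {r..<?k} \<le> (\<Sum>i\<in>{r..<?k}. \<tau>\<^sup>2 * (?z $ i)\<^sup>2)"
    proof (rule sum_mono)
      fix i assume i: "i \<in> {r..<?k}"
      then have "0 \<le> s i" "s i \<le> s r" "s r \<le> \<tau>" using s r by auto
      then have "(s i)\<^sup>2 \<le> \<tau>\<^sup>2" by (intro power_mono) auto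
      then show "g w i \<le> \<tau>\<^sup>2 * (?z $ i)\<^sup>2" by (simp add: g_def mult_right_mono)
    qed
    \<comment> \<open>The sum is refilled to all \<open>k\<close> coordinates so that Bessel's
      inequality applies.\<close>
    also have "\<dots> \<le> (\<Sum>i<?k. \<tau>\<^sup>2 * (?z $ i)\<^sup>2)" by (intro sum_mono2) auto
    also have "\<dots> = \<tau>\<^sup>2 * (?z \<bullet> ?z)"
      using V by (simp add: scalar_prod_self_eq_sum sum_distrib_left)
    also have "\<dots> \<le> \<tau>\<^sup>2 * (w \<bullet> w)" using bessel_inequality[OF V w] by (simp add: mult_left_mono)
    finally show ?thesis using sum_eq[OF w] by (simp add: algebra_simps)
  qed
qed

section \<open>One level of the recursion\<close>

text \<open>With \<open>w = L2^T v\<close>, \<open>K^T\<close> sends \<open>(u, v)\<close> to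
  \<open>(L1^T u + C w, D2^T w)\<close>. Expanding the first square leaves the cross term with
  \<open>L1 C L2^T\<close>, untouched by the truncation in \<open>D2\<close>.\<close>

lemma esif_block_factor_norm:
  fixes L1 :: "real mat"
  assumes L1: "L1 \<in> carrier_mat n1 n1" and L2: "L2 \<in> carrier_mat n2 n2"
    and C: "C \<in> carrier_mat n1 n2" and D2: "D2 \<in> carrier_mat n2 n2"
    and u: "u \<in> carrier_vec n1" and v: "v \<in> carrier_vec n2"
  defines "K \<equiv> four_block_mat L1 (0\<^sub>m n1 n2) (L2 * transpose_mat C) L2 *
       four_block_mat (1\<^sub>m n1) (0\<^sub>m n1 n2) (0\<^sub>m n2 n1) D2"
  defines "w \<equiv> transpose_mat L2 *\<^sub>v v"
  shows "(transpose_mat K *\<^sub>v (u @\<^sub>v v)) \<bullet> (transpose_mat K *\<^sub>v (u @\<^sub>v v)) =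
    (transpose_mat L1 *\<^sub>v u) \<bullet> (transpose_mat L1 *\<^sub>v u) +
    2 * (u \<bullet> ((L1 * C * transpose_mat L2) *\<^sub>v v)) +
    ((C *\<^sub>v w) \<bullet> (C *\<^sub>v w) + (transpose_mat D2 *\<^sub>v w) \<bullet> (transpose_mat D2 *\<^sub>v w))"
proof -
  let ?M1 = "four_block_mat L1 (0\<^sub>m n1 n2) (L2 * transpose_mat C) L2"
  let ?M2 = "four_block_mat (1\<^sub>m n1) (0\<^sub>m n1 n2) (0\<^sub>m n2 n1) D2"
  have M: "?M1 \<in> carrier_mat (n1 + n2) (n1 + n2)" "?M2 \<in> carrier_mat (n1 + n2) (n1 + n2)"
    using L1 L2 D2 by auto
  have w: "w \<in> carrier_vec n2" using L2 v by (simp add: w_def)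
  have Cw: "C *\<^sub>v w \<in> carrier_vec n1" and Lu: "transpose_mat L1 *\<^sub>v u \<in> carrier_vec n1"
    and Dw: "transpose_mat D2 *\<^sub>v w \<in> carrier_vec n2"
    using C w L1 u D2 by auto
  have "transpose_mat (L2 * transpose_mat C) = C * transpose_mat L2"
    using transpose_mult[OF L2, of "transpose_mat C" n1] C by simp
  then have M1t: "transpose_mat ?M1 = four_block_mat (transpose_mat L1) (C * transpose_mat L2)
      (0\<^sub>m n2 n1) (transpose_mat L2)"
    using transpose_four_block_mat[of L1 n1 n1 "0\<^sub>m n1 n2" n2 "L2 * transpose_mat C" n2 L2] L1 L2 C
    by simp
  have M2t: "transpose_mat ?M2 = four_block_mat (1\<^sub>m n1) (0\<^sub>m n1 n2) (0\<^sub>m n2 n1) (transpose_mat D2)"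
    using transpose_four_block_mat[of "1\<^sub>m n1 :: real mat" n1 n1 "0\<^sub>m n1 n2" n2 "0\<^sub>m n2 n1" n2 D2] D2
    by simp
  have CLv: "(C * transpose_mat L2) *\<^sub>v v = C *\<^sub>v w"
    using C L2 v unfolding w_def by (intro assoc_mult_mat_vec[of _ n1 n2 _ n2]) auto
  have 1: "transpose_mat ?M1 *\<^sub>v (u @\<^sub>v v) = (transpose_mat L1 *\<^sub>v u + C *\<^sub>v w) @\<^sub>v w"
    unfolding M1t using L1 L2 C u v w CLv
    by (subst four_block_mat_mult_vec[of _ n1 n1 _ n2 _ n2]) (auto simp: w_def)
  have "transpose_mat K *\<^sub>v (u @\<^sub>v v) = transpose_mat ?M2 *\<^sub>v (transpose_mat ?M1 *\<^sub>v (u @\<^sub>v v))"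
    unfolding K_def transpose_mult[OF M] using M u v
    by (intro assoc_mult_mat_vec[of _ "n1 + n2" "n1 + n2" _ "n1 + n2"]) auto
  also have "\<dots> = (transpose_mat L1 *\<^sub>v u + C *\<^sub>v w) @\<^sub>v (transpose_mat D2 *\<^sub>v w)"
    unfolding 1 M2t using Lu Cw w D2
    by (subst mult_mat_vec_split[of _ n1 _ n2]) auto
  finally have "(transpose_mat K *\<^sub>v (u @\<^sub>v v)) \<bullet> (transpose_mat K *\<^sub>v (u @\<^sub>v v)) =
      (transpose_mat L1 *\<^sub>v u + C *\<^sub>v w) \<bullet> (transpose_mat L1 *\<^sub>v u + C *\<^sub>v w) +
      (transpose_mat D2 *\<^sub>v w) \<bullet> (transpose_mat D2 *\<^sub>v w)"
    using scalar_prod_append[of "transpose_mat L1 *\<^sub>v u + C *\<^sub>v w" n1 "transpose_mat D2 *\<^sub>v w" n2] Lu Cw Dw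
    by simp
  moreover have "(transpose_mat L1 *\<^sub>v u) \<bullet> (C *\<^sub>v w) = u \<bullet> ((L1 * C * transpose_mat L2) *\<^sub>v v)"
  proof -
    have "(L1 * C * transpose_mat L2) *\<^sub>v v = (L1 * C) *\<^sub>v w"
      unfolding w_def using L1 L2 C v by (intro assoc_mult_mat_vec[of _ n1 n2 _ n2]) auto
    also have "\<dots> = L1 *\<^sub>v (C *\<^sub>v w)"
      using L1 C w by (intro assoc_mult_mat_vec) auto
    finally show ?thesis using scalar_prod_mult_mat_vec[OF L1 Cw u] by simp
  qed
  ultimately show ?thesis using scalar_prod_self_add[OF Lu Cw] by simp
qed

text \<open>Scaling by \<open>L1\<close> alone gives \<open>B\<close> with
  \<open>|B v|^2 < v^T A22 v\<close>. Since \<open>L2\<close> dominates \<open>A22\<close>,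
  substituting \<open>v = L2^{-T} w\<close> bounds the right side by \<open>|w|^2\<close> and turns
  \<open>B v\<close> into \<open>C w\<close>. Domination, rather than exact factorization, is all
  that is used of \<open>L1\<close> and \<open>L2\<close>.\<close>

lemma scaled_block_contraction:
  fixes A11 :: "real mat"
  assumes A11: "A11 \<in> carrier_mat n1 n1" and A12: "A12 \<in> carrier_mat n1 n2" and A22: "A22 \<in> carrier_mat n2 n2"
    and spd: "spd_mat (four_block_mat A11 A12 (transpose_mat A12) A22)"
    and L1: "L1 \<in> carrier_mat n1 n1" and L2: "L2 \<in> carrier_mat n2 n2"
    and le1: "\<And>x. x \<in> carrier_vec n1 \<Longrightarrow> x \<bullet> (A11 *\<^sub>v x) \<le> (transpose_mat L1 *\<^sub>v x) \<bullet> (transpose_mat L1 *\<^sub>v x)"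
    and le2: "\<And>x. x \<in> carrier_vec n2 \<Longrightarrow> x \<bullet> (A22 *\<^sub>v x) \<le> (transpose_mat L2 *\<^sub>v x) \<bullet> (transpose_mat L2 *\<^sub>v x)"
  defines "C \<equiv> mat_inv L1 * A12 * transpose_mat (mat_inv L2)"
  shows "C \<in> carrier_mat n1 n2" and "L1 * C * transpose_mat L2 = A12"
    and "w \<in> carrier_vec n2 \<Longrightarrow> w \<noteq> 0\<^sub>v n2 \<Longrightarrow> (C *\<^sub>v w) \<bullet> (C *\<^sub>v w) < w \<bullet> w"
proof -
  have det1: "det L1 \<noteq> 0"
    using det_nonzero_of_dominates_spd[OF A11 spd_four_block(1)[OF A11 A12 A22 spd] L1 le1] .
  have det2: "det L2 \<noteq> 0"
    using det_nonzero_of_dominates_spd[OF A22 spd_four_block(2)[OF A11 A12 A22 spd] L2 le2] .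
  note inv1 = mat_inv_inverse[OF L1 det1] and inv2 = mat_inv_inverse[OF L2 det2]
  define B where "B = mat_inv L1 * A12"
  let ?N = "transpose_mat (mat_inv L2)"
  have B: "B \<in> carrier_mat n1 n2" using inv1 A12 by (simp add: B_def)
  have N: "?N \<in> carrier_mat n2 n2" using inv2 by simp
  have L2t: "transpose_mat L2 \<in> carrier_mat n2 n2" using L2 by simp
  have LB: "L1 * B = A12"
    using inv1 A12 L1 by (simp add: B_def assoc_mult_mat[of L1 n1 n1 "mat_inv L1" n1 A12 n2, symmetric])
  have C_eq: "C = B * ?N" by (simp add: C_def B_def)
  show C: "C \<in> carrier_mat n1 n2" using B N by (simp add: C_eq)
  \<comment> \<open>Both orders are needed: one recovers \<open>A12\<close> from \<open>C\<close>,
    the other shows that \<open>v\<close> below is a preimage of \<open>w\<close> under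
    \<open>L2^T\<close>.\<close>
  have NL: "?N * transpose_mat L2 = 1\<^sub>m n2" "transpose_mat L2 * ?N = 1\<^sub>m n2"
    unfolding transpose_mult[OF L2 inv2(3), symmetric] transpose_mult[OF inv2(3) L2, symmetric]
    using inv2 by auto
  have "L1 * C * transpose_mat L2 = L1 * (C * transpose_mat L2)"
    by (rule assoc_mult_mat[OF L1 C L2t])
  also have "C * transpose_mat L2 = B * (?N * transpose_mat L2)"
    unfolding C_eq by (rule assoc_mult_mat[OF B N L2t])
  finally show "L1 * C * transpose_mat L2 = A12" using NL(1) B LB by simp
  show "(C *\<^sub>v w) \<bullet> (C *\<^sub>v w) < w \<bullet> w" if w: "w \<in> carrier_vec n2" "w \<noteq> 0\<^sub>v n2"
  proof -
    define v where "v = ?N *\<^sub>v w"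
    have v: "v \<in> carrier_vec n2" using N w by (simp add: v_def)
    have L2v: "transpose_mat L2 *\<^sub>v v = w"
      unfolding v_def using assoc_mult_mat_vec[OF L2t N w(1)] NL(2) w(1) by simp
    have "v \<noteq> 0\<^sub>v n2" using L2v w L2t by auto
    then have "(B *\<^sub>v v) \<bullet> (B *\<^sub>v v) < v \<bullet> (A22 *\<^sub>v v)"
      using spd LB by (intro spd_four_block_contraction[OF A11 B A22 L1 det1 _ le1 v]) auto
    also have "\<dots> \<le> w \<bullet> w" using le2[OF v] L2v by simp
    also have "B *\<^sub>v v = C *\<^sub>v w"
      unfolding C_eq v_def by (rule assoc_mult_mat_vec[OF B N w(1), symmetric])
    finally show ?thesis .
  qed
qed

text \<open>The lower bound has to be carried through the induction, since it is what makes the next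
  scaled block a contraction and its Cholesky factor exist. Quantifying over \<open>M\<close> inside
  the statement lets both blocks inherit the bound of the whole matrix.\<close>

lemma esif_bounds:
  assumes "is_esif \<tau> l A L" and "A \<in> carrier_mat n n" and "spd_mat A" and "0 \<le> \<tau>"
  shows "L \<in> carrier_mat n n \<and>
    (\<forall>x \<in> carrier_vec n. x \<bullet> (A *\<^sub>v x) \<le> (transpose_mat L *\<^sub>v x) \<bullet> (transpose_mat L *\<^sub>v x)) \<and>
    (\<forall>M \<ge> 0. (\<forall>x \<in> carrier_vec n. x \<bullet> (A *\<^sub>v x) \<le> M * (x \<bullet> x)) \<longrightarrow>
      (\<forall>x \<in> carrier_vec n. (transpose_mat L *\<^sub>v x) \<bullet> (transpose_mat L *\<^sub>v x) \<le>
         x \<bullet> (A *\<^sub>v x) + ((1 + \<tau>\<^sup>2) ^ l - 1) * M * (x \<bullet> x)))"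
  using assms(1-3)
proof (induction arbitrary: n)
  case (level_0 A)
  \<comment> \<open>At level 0 the factor is exact, matching an error coefficient of
    \<open>1 - 1 = 0\<close>.\<close>
  then show ?case using cholesky_gram[of A n] gram_form[of "cholesky A" n n] by auto
next
  case (level_Suc A11 n1 A12 n2 A22 A l L1 L2 C U s V r V1 S1 D2)
  note A11 = level_Suc.hyps(1) and A12 = level_Suc.hyps(2) and A22 = level_Suc.hyps(3)
    and A_eq = level_Suc.hyps(4)
  have n: "n = n1 + n2" using level_Suc.prems A11 A22 by (auto simp: A_eq)
  have spd: "spd_mat (four_block_mat A11 A12 (transpose_mat A12) A22)"
    using level_Suc.prems A_eq by simp
  note IH1 = level_Suc.IH(1)[OF A11 spd_four_block(1)[OF A11 A12 A22 spd]]
  note IH2 = level_Suc.IH(2)[OF A22 spd_four_block(2)[OF A11 A12 A22 spd]]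
  have L1: "L1 \<in> carrier_mat n1 n1" and L2: "L2 \<in> carrier_mat n2 n2"
    and le1: "\<And>x. x \<in> carrier_vec n1 \<Longrightarrow> x \<bullet> (A11 *\<^sub>v x) \<le> (transpose_mat L1 *\<^sub>v x) \<bullet> (transpose_mat L1 *\<^sub>v x)"
    and le2: "\<And>x. x \<in> carrier_vec n2 \<Longrightarrow> x \<bullet> (A22 *\<^sub>v x) \<le> (transpose_mat L2 *\<^sub>v x) \<bullet> (transpose_mat L2 *\<^sub>v x)"
    using IH1 IH2 by auto
  have D2_eq: "D2 = cholesky (1\<^sub>m n2 - leading_cols r V * (mat_diag r s * mat_diag r s) *
      transpose_mat (leading_cols r V))"
    using level_Suc.hyps by simp
  have C: "C \<in> carrier_mat n1 n2" and LCL: "L1 * C * transpose_mat L2 = A12"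
    and contr: "\<And>w. w \<in> carrier_vec n2 \<Longrightarrow> w \<noteq> 0\<^sub>v n2 \<Longrightarrow> (C *\<^sub>v w) \<bullet> (C *\<^sub>v w) < w \<bullet> w"
    using scaled_block_contraction[OF A11 A12 A22 spd L1 L2 le1 le2]
    unfolding level_Suc.hyps(7)[symmetric] by blast+
  have trunc: "D2 \<in> carrier_mat n2 n2"
    "\<And>w. w \<in> carrier_vec n2 \<Longrightarrow>
      w \<bullet> w \<le> (C *\<^sub>v w) \<bullet> (C *\<^sub>v w) + (transpose_mat D2 *\<^sub>v w) \<bullet> (transpose_mat D2 *\<^sub>v w)"
    "\<And>w. w \<in> carrier_vec n2 \<Longrightarrow>
      (C *\<^sub>v w) \<bullet> (C *\<^sub>v w) + (transpose_mat D2 *\<^sub>v w) \<bullet> (transpose_mat D2 *\<^sub>v w) \<le> (1 + \<tau>\<^sup>2) * (w \<bullet> w)"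
    unfolding D2_eq
    by (rule truncated_factor_bounds[OF C level_Suc.hyps(8,9) \<open>0 \<le> \<tau>\<close>]; (erule (1) contr | assumption))+
  let ?K = "four_block_mat L1 (0\<^sub>m n1 n2) (L2 * transpose_mat C) L2 *
       four_block_mat (1\<^sub>m n1) (0\<^sub>m n1 n2) (0\<^sub>m n2 n1) D2"
  let ?c = "(1 + \<tau>\<^sup>2) ^ l"
  have K: "?K \<in> carrier_mat n n"
    unfolding n using L1 L2 trunc(1) by (intro mult_carrier_mat four_block_carrier_mat) auto
  have norm_K: "(transpose_mat ?K *\<^sub>v (u @\<^sub>v v)) \<bullet> (transpose_mat ?K *\<^sub>v (u @\<^sub>v v)) =
      (transpose_mat L1 *\<^sub>v u) \<bullet> (transpose_mat L1 *\<^sub>v u) + 2 * (u \<bullet> (A12 *\<^sub>v v)) +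
      ((C *\<^sub>v (transpose_mat L2 *\<^sub>v v)) \<bullet> (C *\<^sub>v (transpose_mat L2 *\<^sub>v v)) +
       (transpose_mat D2 *\<^sub>v (transpose_mat L2 *\<^sub>v v)) \<bullet> (transpose_mat D2 *\<^sub>v (transpose_mat L2 *\<^sub>v v)))"
    if "u \<in> carrier_vec n1" "v \<in> carrier_vec n2" for u v
    using esif_block_factor_norm[OF L1 L2 C trunc(1) that] LCL by simp
  have form_A: "(u @\<^sub>v v) \<bullet> (A *\<^sub>v (u @\<^sub>v v)) =
      u \<bullet> (A11 *\<^sub>v u) + 2 * (u \<bullet> (A12 *\<^sub>v v)) + v \<bullet> (A22 *\<^sub>v v)"
    if "u \<in> carrier_vec n1" "v \<in> carrier_vec n2" for u v
    unfolding A_eq by (rule four_block_form[OF A11 A12 A22 that])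
  have split: "\<exists>u v. x = u @\<^sub>v v \<and> u \<in> carrier_vec n1 \<and> v \<in> carrier_vec n2"
    if "x \<in> carrier_vec n" for x :: "real vec"
    using that vec_first_last_append[of x n1 n2] n by (metis vec_first_carrier vec_last_carrier)
  have lower: "x \<bullet> (A *\<^sub>v x) \<le> (transpose_mat ?K *\<^sub>v x) \<bullet> (transpose_mat ?K *\<^sub>v x)"
    if "x \<in> carrier_vec n" for x
  proof -
    obtain u v where x: "x = u @\<^sub>v v" and u: "u \<in> carrier_vec n1" and v: "v \<in> carrier_vec n2"
      using split \<open>x \<in> carrier_vec n\<close> by blast
    have "transpose_mat L2 *\<^sub>v v \<in> carrier_vec n2" using L2 v by simp
    \<comment> \<open>The cross terms with \<open>A12\<close> agree on both sides, so it remains to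
      add the inequalities for the two diagonal blocks.\<close>
    from trunc(2)[OF this] show ?thesis
      unfolding x using norm_K[OF u v] form_A[OF u v] le1[OF u] le2[OF v] by linarith
  qed
  have upper: "(transpose_mat ?K *\<^sub>v x) \<bullet> (transpose_mat ?K *\<^sub>v x) \<le>
      x \<bullet> (A *\<^sub>v x) + ((1 + \<tau>\<^sup>2) ^ Suc l - 1) * M * (x \<bullet> x)"
    if M: "0 \<le> M" and AM: "\<forall>x \<in> carrier_vec n. x \<bullet> (A *\<^sub>v x) \<le> M * (x \<bullet> x)"
      and x_carrier: "x \<in> carrier_vec n" for M x
  proof -
    obtain u v where x: "x = u @\<^sub>v v" and u: "u \<in> carrier_vec n1" and v: "v \<in> carrier_vec n2"
      using split x_carrier by blast
    \<comment> \<open>Padding with zeros transfers the bound \<open>M\<close> from \<open>A\<close>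
      to each diagonal block.\<close>
    have A11M: "y \<bullet> (A11 *\<^sub>v y) \<le> M * (y \<bullet> y)" if y: "y \<in> carrier_vec n1" for y
      using form_A[OF y zero_carrier_vec] AM[rule_format, of "y @\<^sub>v 0\<^sub>v n2"] y n mult_mat_zero_vec[OF A12] mult_mat_zero_vec[OF A22]
        scalar_prod_append[OF y zero_carrier_vec[of n2] y zero_carrier_vec[of n2]]
      by simp
    have A22M: "y \<bullet> (A22 *\<^sub>v y) \<le> M * (y \<bullet> y)" if y: "y \<in> carrier_vec n2" for y
      using form_A[OF zero_carrier_vec y] AM[rule_format, of "0\<^sub>v n1 @\<^sub>v y"] y n A12 mult_mat_zero_vec[OF A11]
        scalar_prod_append[OF zero_carrier_vec[of n1] y zero_carrier_vec[of n1] y]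
      by simp
    define p where "p = (transpose_mat L1 *\<^sub>v u) \<bullet> (transpose_mat L1 *\<^sub>v u)"
    define q where "q = (transpose_mat L2 *\<^sub>v v) \<bullet> (transpose_mat L2 *\<^sub>v v)"
    have L2v: "transpose_mat L2 *\<^sub>v v \<in> carrier_vec n2" using L2 v by simp
    have p: "p \<le> u \<bullet> (A11 *\<^sub>v u) + (?c - 1) * M * (u \<bullet> u)"
      using IH1 M A11M u unfolding p_def by blast
    have q: "q \<le> v \<bullet> (A22 *\<^sub>v v) + (?c - 1) * M * (v \<bullet> v)"
      using IH2 M A22M v unfolding q_def by blast
    \<comment> \<open>This is where the error compounds. Truncation adds
      \<open>\<tau>\<^sup>2 q\<close>, and \<open>q\<close> itself is at most
      \<open>?c * M * |v|^2\<close>, so the coefficient grows from \<open>?c - 1\<close> to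
      \<open>?c - 1 + \<tau>\<^sup>2 * ?c\<close>, which is the one for level
      \<open>Suc l\<close>.\<close>
    have "q \<le> ?c * M * (v \<bullet> v)" using q A22M[OF v] by (simp add: algebra_simps)
    then have "\<tau>\<^sup>2 * q \<le> \<tau>\<^sup>2 * (?c * M * (v \<bullet> v))" by (rule mult_left_mono) simp
    then have q': "(1 + \<tau>\<^sup>2) * q \<le> v \<bullet> (A22 *\<^sub>v v) + ((1 + \<tau>\<^sup>2) ^ Suc l - 1) * M * (v \<bullet> v)"
      using q by (simp add: algebra_simps)
    \<comment> \<open>The first block suffers no new truncation; its smaller coefficient is enlarged
      to match the second, which uses \<open>0 <= M\<close>.\<close>
    have "?c \<le> (1 + \<tau>\<^sup>2) ^ Suc l" by (rule power_increasing) auto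
    then have "(?c - 1) * (M * (u \<bullet> u)) \<le> ((1 + \<tau>\<^sup>2) ^ Suc l - 1) * (M * (u \<bullet> u))"
      using M scalar_prod_self_nonneg[of u] by (intro mult_right_mono) auto
    then have p': "p \<le> u \<bullet> (A11 *\<^sub>v u) + ((1 + \<tau>\<^sup>2) ^ Suc l - 1) * M * (u \<bullet> u)"
      using p by (simp only: mult.assoc)
    have xx: "x \<bullet> x = u \<bullet> u + v \<bullet> v" unfolding x by (rule scalar_prod_append[OF u v u v])
    have "(transpose_mat ?K *\<^sub>v x) \<bullet> (transpose_mat ?K *\<^sub>v x) \<le> p + 2 * (u \<bullet> (A12 *\<^sub>v v)) + (1 + \<tau>\<^sup>2) * q"
      using trunc(3)[OF L2v] norm_K[OF u v] unfolding x p_def q_def by linarith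
    also have "\<dots> \<le> x \<bullet> (A *\<^sub>v x) + ((1 + \<tau>\<^sup>2) ^ Suc l - 1) * M * (x \<bullet> x)"
      unfolding xx distrib_left using p' q' form_A[OF u v] unfolding x by linarith
    finally show ?thesis .
  qed
  show ?case using K lower upper by blast
qed

section \<open>Spectral norms\<close>

lemma vec_norm2_nonneg: "0 \<le> vec_norm2 x"
  by (simp add: vec_norm2_def scalar_prod_self_nonneg)

lemma vec_norm2_power2: "(vec_norm2 x)\<^sup>2 = x \<bullet> x"
  by (simp add: vec_norm2_def scalar_prod_self_nonneg)

lemma vec_norm2_smult: "vec_norm2 (c \<cdot>\<^sub>v x) = \<bar>c\<bar> * vec_norm2 x"
  by (simp add: vec_norm2_def real_sqrt_mult flip: mult.assoc)

text \<open>The form at \<open>x + t y\<close> is a nonnegative polynomial in \<open>t\<close>.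
  Semidefiniteness allows its leading coefficient to vanish, so that case is separate.\<close>

lemma psd_cauchy_schwarz:
  assumes "psd_mat E" and E: "E \<in> carrier_mat n n" and x: "x \<in> carrier_vec n" and y: "y \<in> carrier_vec n"
  shows "(x \<bullet> (E *\<^sub>v y))\<^sup>2 \<le> (x \<bullet> (E *\<^sub>v x)) * (y \<bullet> (E *\<^sub>v y))"
proof -
  let ?a = "x \<bullet> (E *\<^sub>v x)" and ?b = "x \<bullet> (E *\<^sub>v y)" and ?c = "y \<bullet> (E *\<^sub>v y)"
  have Et: "transpose_mat E = E" and nonneg: "\<And>z. z \<in> carrier_vec n \<Longrightarrow> 0 \<le> z \<bullet> (E *\<^sub>v z)"
    using assms by (auto simp: psd_mat_def)
  have sym: "y \<bullet> (E *\<^sub>v x) = ?b"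
    using scalar_prod_mult_mat_vec[OF E x y] comm_scalar_prod[of x n "E *\<^sub>v y"] Et E x y by simp
  have quad: "0 \<le> ?a + 2 * t * ?b + t\<^sup>2 * ?c" for t
  proof -
    have "0 \<le> (x + t \<cdot>\<^sub>v y) \<bullet> (E *\<^sub>v (x + t \<cdot>\<^sub>v y))" using x y by (intro nonneg) auto
    also have "E *\<^sub>v (x + t \<cdot>\<^sub>v y) = E *\<^sub>v x + t \<cdot>\<^sub>v (E *\<^sub>v y)"
      using E x y by (simp add: mult_add_distrib_mat_vec[of _ n n] mult_mat_vec[of _ n n])
    finally show ?thesis using E x y sym
      by (simp add: add_scalar_prod_distrib[of _ n] scalar_prod_add_distrib[of _ n]
          power2_eq_square algebra_simps)
  qed
  show ?thesis
  proof (cases "?c = 0")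
    case True
    have "?b = 0"
    proof (rule ccontr)
      assume "?b \<noteq> 0"
      \<comment> \<open>A nonconstant linear polynomial takes the value -1; this \<open>t\<close> is
        where it does.\<close>
      then have "?a + 2 * (- (?a + 1) / (2 * ?b)) * ?b + (- (?a + 1) / (2 * ?b))\<^sup>2 * ?c = - 1"
        using True by (simp add: field_simps)
      then show False using quad[of "- (?a + 1) / (2 * ?b)"] by linarith
    qed
    then show ?thesis using True by simp
  next
    case False
    then have c: "0 < ?c" using nonneg[OF y] by simp
    \<comment> \<open>The minimiser of the quadratic is \<open>t = - ?b / ?c\<close>.\<close>
    have "?a + 2 * (- ?b / ?c) * ?b + (- ?b / ?c)\<^sup>2 * ?c = ?a - ?b\<^sup>2 / ?c"
      using c by (simp add: power2_eq_square field_simps)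
    then have "?b\<^sup>2 / ?c \<le> ?a" using quad[of "- ?b / ?c"] by linarith
    then show ?thesis using c by (simp add: pos_divide_le_eq)
  qed
qed

lemma vec_norm2_cauchy_schwarz:
  assumes x: "x \<in> carrier_vec n" and y: "y \<in> carrier_vec n"
  shows "x \<bullet> y \<le> vec_norm2 x * vec_norm2 y"
proof (rule power2_le_imp_le)
  have "psd_mat (1\<^sub>m n)" by (auto simp: psd_mat_def scalar_prod_self_nonneg)
  from psd_cauchy_schwarz[OF this one_carrier_mat x y]
  show "(x \<bullet> y)\<^sup>2 \<le> (vec_norm2 x * vec_norm2 y)\<^sup>2"
    using x y by (simp add: power_mult_distrib vec_norm2_power2)
qed (simp add: vec_norm2_nonneg)

text \<open>\<open>Sup\<close> on the reals is informative only for bounded sets; the bound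
  \<open>K\<close> is the Frobenius norm, obtained row by row from Cauchy-Schwarz.\<close>

lemma spectral_norm_bdd_above:
  assumes M: "M \<in> carrier_mat m n"
  shows "bdd_above {vec_norm2 (M *\<^sub>v x) | x. x \<in> carrier_vec (dim_col M) \<and> vec_norm2 x \<le> 1}"
proof -
  define K where "K = sqrt (\<Sum>i<m. (vec_norm2 (row M i))\<^sup>2)"
  have "vec_norm2 (M *\<^sub>v x) \<le> K" if x: "x \<in> carrier_vec n" "vec_norm2 x \<le> 1" for x
  proof -
    have "((M *\<^sub>v x) $ i)\<^sup>2 \<le> (vec_norm2 (row M i))\<^sup>2" if i: "i < m" for i
    proof -
      \<comment> \<open>Applying Cauchy-Schwarz to \<open>y\<close> and to \<open>- y\<close> gives
        the absolute value.\<close>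
      have "\<bar>row M i \<bullet> y\<bar> \<le> vec_norm2 (row M i) * vec_norm2 y" if "y \<in> carrier_vec n" for y
        using vec_norm2_cauchy_schwarz[of "row M i" n y] vec_norm2_cauchy_schwarz[of "row M i" n "- y"]
          M i that row_carrier_vec[of i m M n] by (auto simp: vec_norm2_def)
      then have "\<bar>row M i \<bullet> x\<bar> \<le> vec_norm2 (row M i) * vec_norm2 x" using x by blast
      also have "\<dots> \<le> vec_norm2 (row M i) * 1"
        using x vec_norm2_nonneg by (intro mult_left_mono) auto
      finally show ?thesis
        using abs_le_square_iff[of "row M i \<bullet> x" "vec_norm2 (row M i)"] vec_norm2_nonneg[of "row M i"] M i
        by simp
    qed
    then have "(M *\<^sub>v x) \<bullet> (M *\<^sub>v x) \<le> (\<Sum>i<m. (vec_norm2 (row M i))\<^sup>2)"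
      using M by (auto simp: scalar_prod_self_eq_sum intro!: sum_mono)
    then show ?thesis by (simp add: K_def vec_norm2_def)
  qed
  then show ?thesis using M by (intro bdd_aboveI[of _ K]) auto
qed

lemma vec_norm2_mult_le_spectral_norm:
  assumes M: "M \<in> carrier_mat m n" and x: "x \<in> carrier_vec n"
  shows "vec_norm2 (M *\<^sub>v x) \<le> spectral_norm M * vec_norm2 x"
proof (cases "x = 0\<^sub>v n")
  case True
  then show ?thesis using mult_mat_zero_vec[OF M] by (simp add: vec_norm2_def)
next
  case False
  then have pos: "0 < vec_norm2 x" using scalar_prod_self_pos[OF x] by (simp add: vec_norm2_def)
  define y where "y = (1 / vec_norm2 x) \<cdot>\<^sub>v x"
  have y: "y \<in> carrier_vec n" "vec_norm2 y \<le> 1"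
    using x pos by (auto simp: y_def vec_norm2_smult)
  have "vec_norm2 (M *\<^sub>v y) \<le> spectral_norm M"
    unfolding spectral_norm_def using y M by (intro cSup_upper spectral_norm_bdd_above[OF M]) auto
  moreover have "M *\<^sub>v y = (1 / vec_norm2 x) \<cdot>\<^sub>v (M *\<^sub>v x)"
    unfolding y_def by (rule mult_mat_vec[OF M x])
  ultimately show ?thesis using pos by (simp add: vec_norm2_smult field_simps)
qed

lemma spectral_norm_le:
  assumes M: "M \<in> carrier_mat m n" and K: "0 \<le> K"
    and le: "\<And>x. x \<in> carrier_vec n \<Longrightarrow> vec_norm2 (M *\<^sub>v x) \<le> K * vec_norm2 x"
  shows "spectral_norm M \<le> K"
  unfolding spectral_norm_def
proof (rule cSup_least)
  \<comment> \<open>The zero vector is in the unit ball in every dimension, including 0, so the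
    supremum is over a nonempty set.\<close>
  have "vec_norm2 (M *\<^sub>v 0\<^sub>v n) \<in> {vec_norm2 (M *\<^sub>v x) | x. x \<in> carrier_vec (dim_col M) \<and> vec_norm2 x \<le> 1}"
    using M by (auto simp: vec_norm2_def intro!: exI[of _ "0\<^sub>v n"])
  then show "{vec_norm2 (M *\<^sub>v x) | x. x \<in> carrier_vec (dim_col M) \<and> vec_norm2 x \<le> 1} \<noteq> {}" by blast
next
  fix b assume "b \<in> {vec_norm2 (M *\<^sub>v x) | x. x \<in> carrier_vec (dim_col M) \<and> vec_norm2 x \<le> 1}"
  then obtain x where x: "b = vec_norm2 (M *\<^sub>v x)" "x \<in> carrier_vec n" "vec_norm2 x \<le> 1"
    using M by auto
  then have "b \<le> K * vec_norm2 x" using le by simp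
  also have "\<dots> \<le> K * 1" using K x by (intro mult_left_mono) auto
  finally show "b \<le> K" by simp
qed

lemma spectral_norm_nonneg:
  assumes M: "M \<in> carrier_mat m n"
  shows "0 \<le> spectral_norm M"
proof -
  have "vec_norm2 (M *\<^sub>v 0\<^sub>v n) \<le> spectral_norm M"
    unfolding spectral_norm_def using M
    by (intro cSup_upper spectral_norm_bdd_above[OF M]) (auto simp: vec_norm2_def intro!: exI[of _ "0\<^sub>v n"])
  then show ?thesis using vec_norm2_nonneg[of "M *\<^sub>v 0\<^sub>v n"] by linarith
qed

lemma form_le_spectral_norm:
  assumes A: "A \<in> carrier_mat n n" and x: "x \<in> carrier_vec n"
  shows "x \<bullet> (A *\<^sub>v x) \<le> spectral_norm A * (x \<bullet> x)"
proof -
  have "x \<bullet> (A *\<^sub>v x) \<le> vec_norm2 x * vec_norm2 (A *\<^sub>v x)"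
    using A x by (intro vec_norm2_cauchy_schwarz[of _ n]) auto
  also have "\<dots> \<le> vec_norm2 x * (spectral_norm A * vec_norm2 x)"
    using vec_norm2_mult_le_spectral_norm[OF A x] vec_norm2_nonneg by (rule mult_left_mono)
  also have "\<dots> = spectral_norm A * (x \<bullet> x)"
    by (simp add: vec_norm2_power2[symmetric] power2_eq_square)
  finally show ?thesis .
qed

text \<open>Avoids eigenvalues: Cauchy-Schwarz for the form of \<open>E\<close> with
  \<open>y = E x\<close> gives \<open>|y|^4 <= (y^T E y) (x^T E x) <= K^2 |y|^2 |x|^2\<close>, and
  one factor \<open>|y|^2\<close> cancels.\<close>

lemma psd_spectral_norm_le:
  assumes psd: "psd_mat E" and E: "E \<in> carrier_mat n n" and K: "0 \<le> K"
    and le: "\<And>x. x \<in> carrier_vec n \<Longrightarrow> x \<bullet> (E *\<^sub>v x) \<le> K * (x \<bullet> x)"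
  shows "spectral_norm E \<le> K"
proof (rule spectral_norm_le[OF E K])
  fix x :: "real vec" assume x: "x \<in> carrier_vec n"
  define y where "y = E *\<^sub>v x"
  have y: "y \<in> carrier_vec n" using E x by (simp add: y_def)
  have "(y \<bullet> y)\<^sup>2 \<le> (y \<bullet> (E *\<^sub>v y)) * (x \<bullet> (E *\<^sub>v x))"
    using psd_cauchy_schwarz[OF psd E y x] by (simp add: y_def)
  also have "\<dots> \<le> (K * (y \<bullet> y)) * (K * (x \<bullet> x))"
    using le[OF x] le[OF y] psd E x y K scalar_prod_self_nonneg[of y]
    by (intro mult_mono) (auto simp: psd_mat_def)
  finally have "(y \<bullet> y) * (y \<bullet> y) \<le> (y \<bullet> y) * (K\<^sup>2 * (x \<bullet> x))"
    by (simp add: power2_eq_square algebra_simps)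
  then have "y \<bullet> y \<le> K\<^sup>2 * (x \<bullet> x)"
    using scalar_prod_self_nonneg[of x] scalar_prod_self_nonneg[of y]
    by (cases "y \<bullet> y = 0") (auto simp: mult_le_cancel_left)
  then have "(vec_norm2 y)\<^sup>2 \<le> (K * vec_norm2 x)\<^sup>2"
    by (simp add: vec_norm2_power2 power_mult_distrib)
  then show "vec_norm2 (E *\<^sub>v x) \<le> K * vec_norm2 x"
    unfolding y_def using mult_nonneg_nonneg[OF K vec_norm2_nonneg[of x]] by (rule power2_le_imp_le)
qed

theorem theorem3p1:
  fixes A L :: "real mat" and n l :: nat and \<tau> :: real
  assumes "A \<in> carrier_mat n n" and "spd_mat A"
    and "l \<ge> 1" and "0 \<le> \<tau>" and "\<tau> < 1"
    and "is_esif \<tau> l A L"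
  shows "spd_mat (L * transpose_mat L) \<and>
    (\<exists>E \<in> carrier_mat n n. L * transpose_mat L = A + E \<and> psd_mat E \<and>
       spectral_norm E / spectral_norm A \<le> (1 + \<tau>\<^sup>2) ^ l - 1)"
proof -
  note A = assms(1) and spd = assms(2)
  define G where "G = L * transpose_mat L"
  define E where "E = G - A"
  let ?c = "(1 + \<tau>\<^sup>2) ^ l - 1" and ?M = "spectral_norm A"
  have c: "0 \<le> ?c" by simp
  have M: "0 \<le> ?M" by (rule spectral_norm_nonneg[OF A])
  have L: "L \<in> carrier_mat n n"
    and lower: "\<And>x. x \<in> carrier_vec n \<Longrightarrow> x \<bullet> (A *\<^sub>v x) \<le> (transpose_mat L *\<^sub>v x) \<bullet> (transpose_mat L *\<^sub>v x)"
    and upper: "\<And>x. x \<in> carrier_vec n \<Longrightarrow>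
      (transpose_mat L *\<^sub>v x) \<bullet> (transpose_mat L *\<^sub>v x) \<le> x \<bullet> (A *\<^sub>v x) + ?c * ?M * (x \<bullet> x)"
    \<comment> \<open>Here \<open>M\<close> becomes the spectral norm of \<open>A\<close>, which
      bounds its form by Cauchy-Schwarz.\<close>
    using esif_bounds[OF assms(6) A spd assms(4)] M form_le_spectral_norm[OF A] by blast+
  have G: "G \<in> carrier_mat n n" using L by (simp add: G_def)
  have Gt: "transpose_mat G = G" using transpose_mult[OF L, of "transpose_mat L" n] L by (simp add: G_def)
  have E: "E \<in> carrier_mat n n" unfolding E_def using A by (rule minus_carrier_mat)
  have form_G: "x \<bullet> (G *\<^sub>v x) = (transpose_mat L *\<^sub>v x) \<bullet> (transpose_mat L *\<^sub>v x)"
    if "x \<in> carrier_vec n" for x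
    unfolding G_def by (rule gram_form[OF L that])
  have form_E: "x \<bullet> (E *\<^sub>v x) = x \<bullet> (G *\<^sub>v x) - x \<bullet> (A *\<^sub>v x)" if x: "x \<in> carrier_vec n" for x
    using minus_mult_distrib_mat_vec[OF G A x] scalar_prod_minus_distrib[OF x, of "G *\<^sub>v x" "A *\<^sub>v x"] G A x
    by (simp add: E_def)
  have "spd_mat G"
  proof (rule spd_matI[OF G Gt])
    fix x :: "real vec" assume x: "x \<in> carrier_vec n" "x \<noteq> 0\<^sub>v n"
    show "0 < x \<bullet> (G *\<^sub>v x)"
      using spd_mat_pos[OF spd A x] lower[OF x(1)] form_G[OF x(1)] by linarith
  qed
  moreover have "G = A + E" using G A by (auto simp: E_def intro!: eq_matI)
  moreover have psd: "psd_mat E"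
    using E lower form_G form_E transpose_minus[OF G A] Gt spd
    by (auto simp: psd_mat_def spd_mat_def E_def)
  moreover have "spectral_norm E / ?M \<le> ?c"
  proof -
    have "spectral_norm E \<le> ?c * ?M"
    proof (rule psd_spectral_norm_le[OF psd E])
      show "0 \<le> ?c * ?M" using c M by (rule mult_nonneg_nonneg)
      show "x \<bullet> (E *\<^sub>v x) \<le> ?c * ?M * (x \<bullet> x)" if "x \<in> carrier_vec n" for x
        using upper[OF that] form_G[OF that] form_E[OF that] by linarith
    qed
    \<comment> \<open>A zero norm occurs only in dimension 0, since \<open>A\<close> is positive
      definite; division by zero then gives 0, still at most \<open>?c\<close>.\<close>
    then show ?thesis using M c by (cases "?M = 0") (auto simp: divide_le_eq)
  qed
  ultimately show ?thesis using E unfolding G_def by blast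
qed

end
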